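(* Let $r \in \mathbb{N}_0$, let $D \subset \mathbb{R}$ be open, let $f : D \to \mathbb{R}$ be $(r+1)$-times continuously differentiable, let $T>0$, and suppose $y : [0,T] \to D$ solves the initial value problem $\dot{y}(t) = f(y(t))$ on $0 \leq t \leq T$, $y(0) = y_0 \in D$. Let $\Phi : U_{\max} \to \mathbb{R}$ be the Taylor method of order parameter $r$ associated with $f$ (as defined in the context). Then $\Phi$ is a convergent $1$-step method of order $r+1$ for the approximation of $y$ on $[0,T]$; that is, for every compact neighborhood $K \subset D$ with $y([0,T]) \subset \mathring{K}$ there exist $N_0 \in \mathbb{N}$ and a constant $M \geq 0$ such that for all $N \geq N_0$, with $h = \frac{T}{N}$, the sequence $y_0^{(N)},\ldots,y_N^{(N)}$ given by $$y_0^{(N)} = y_0, \qquad y_{n+1}^{(N)} = \Phi\bigl(h,y_n^{(N)}\bigr), \quad n=0,\ldots,N-1,$$ is well-defined, all $y_n^{(N)} \in \mathring{K}$, and $$\max_{0 \leq n \leq N} \bigl|y(nh) - y_n^{(N)}\bigr| \leq M h^{r+1}.$$ Moreover, the method is exact when $f$ is (the restriction to $D$ of) a polynomial of degree at most $r$: in that case $y_n^{(N)} = y(nh)$ for all $n = 0,\ldots,N$, for every $N \in \mathbb{N}$ (with $h = \frac{T}{N}$) for which the sequence is well-defined.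
   Context: Definition of the method $\Phi$. Define $F : \mathbb{R}\times D \to \mathbb{R}$ by $$F(w,y) = \sum_{j=0}^{r} \frac{f^{(j)}(y)}{j!}w^j .$$ For each $y \in D$ (regarded as a parameter) let $h \mapsto w(h,y)$ be the maximally extended solution, defined on an open interval $(h_{\min}(y),h_{\max}(y))$ containing $0$, of $$\frac{\partial w}{\partial h}(h,y) = F(w(h,y),y), \qquad w(0,y) = 0,$$ and let $U_{\max} = \{(h,y) :\ y \in D,\ h_{\min}(y) < h < h_{\max}(y)\} \subset \mathbb{R}\times D$. Define $\Phi : U_{\max} \to \mathbb{R}$ by $\Phi(h,y) = y + w(h,y)$. Thus, for fixed $y$, $\Phi(\cdot,y)$ is the exact solution of the differential equation in which $f$ is replaced by its $r$-th order Taylor polynomial centered at $y$, with initial value $y$. A sequence $y_0^{(N)},\ldots,y_N^{(N)}$ as in the claim is well-defined if $y_n^{(N)}\in D$ and $(h,y_n^{(N)}) \in U_{\max}$ for $n = 0,\ldots,N-1$. $\mathring{K}$ denotes the interior of $K$. $\mathbb{N}_0 = \{0,1,2,\ldots\}$ and $\mathbb{N} = \{1,2,\ldots\}$. *)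

theory Defs
  imports "HOL-Analysis.Analysis"
begin

text \<open>
  Functions on a set \<open>D\<close> or on an interval are total functions whose values outside that set are
  irrelevant. For open \<open>D\<close>, the iterated \<^const>\<open>deriv\<close> at points of \<open>D\<close> depends only on the
  restriction of the function to \<open>D\<close>.
\<close>

definition continuously_differentiable_times_on ::
    "nat \<Rightarrow> (real \<Rightarrow> real) \<Rightarrow> real set \<Rightarrow> bool" where
  "continuously_differentiable_times_on k f D \<longleftrightarrow>
     (\<forall>j<k. (deriv ^^ j) f differentiable_on D) \<and> continuous_on D ((deriv ^^ k) f)"

definition taylor_rhs :: "nat \<Rightarrow> (real \<Rightarrow> real) \<Rightarrow> real \<Rightarrow> real \<Rightarrow> real" where
  "taylor_rhs r f w y = (\<Sum>j\<le>r. (deriv ^^ j) f y / fact j * w ^ j)"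

definition autonomous_solution ::
    "(real \<Rightarrow> real) \<Rightarrow> real \<Rightarrow> real set \<Rightarrow> (real \<Rightarrow> real) \<Rightarrow> bool" where
  "autonomous_solution g x0 I u \<longleftrightarrow>
     is_interval I \<and> open I \<and> 0 \<in> I \<and> u 0 = x0 \<and>
     (\<forall>t\<in>I. (u has_real_derivative g (u t)) (at t))"

definition maximal_solution ::
    "(real \<Rightarrow> real) \<Rightarrow> real \<Rightarrow> real set \<Rightarrow> (real \<Rightarrow> real) \<Rightarrow> bool" where
  "maximal_solution g x0 I u \<longleftrightarrow>
     autonomous_solution g x0 I u \<and>
     (\<forall>J v. autonomous_solution g x0 J v \<and> I \<subseteq> J \<and> (\<forall>t\<in>I. v t = u t) \<longrightarrow> J = I)"

text \<open>
  For locally Lipschitz \<open>g\<close> the maximally extended solution exists, and both its interval and its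
  values on that interval are unique; the choice in \<open>maximal_flow\<close> only affects the junk values
  outside of \<open>maximal_interval\<close>.
\<close>

definition maximal_interval :: "(real \<Rightarrow> real) \<Rightarrow> real \<Rightarrow> real set" where
  "maximal_interval g x0 = (THE I. \<exists>u. maximal_solution g x0 I u)"

definition maximal_flow :: "(real \<Rightarrow> real) \<Rightarrow> real \<Rightarrow> real \<Rightarrow> real" where
  "maximal_flow g x0 = (SOME u. maximal_solution g x0 (maximal_interval g x0) u)"

text \<open>\<open>taylor_domain\<close> is \<open>U\<^sub>m\<^sub>a\<^sub>x\<close>; its slice at \<open>y\<close> is the interval \<open>(h\<^sub>m\<^sub>i\<^sub>n(y), h\<^sub>m\<^sub>a\<^sub>x(y))\<close>.\<close>

definition taylor_domain :: "nat \<Rightarrow> (real \<Rightarrow> real) \<Rightarrow> real set \<Rightarrow> (real \<times> real) set" where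
  "taylor_domain r f D = {(h, y). y \<in> D \<and> h \<in> maximal_interval (\<lambda>w. taylor_rhs r f w y) 0}"

definition taylor_step :: "nat \<Rightarrow> (real \<Rightarrow> real) \<Rightarrow> real \<Rightarrow> real \<Rightarrow> real" where
  "taylor_step r f h y = y + maximal_flow (\<lambda>w. taylor_rhs r f w y) 0 h"

text \<open>
  The sequence is total because \<open>\<Phi>\<close> is; its entries up to index \<open>N\<close> are meaningful
  exactly if \<open>one_step_well_defined\<close> holds.
\<close>

primrec one_step_seq :: "(real \<Rightarrow> real \<Rightarrow> real) \<Rightarrow> real \<Rightarrow> real \<Rightarrow> nat \<Rightarrow> real" where
  "one_step_seq \<Phi> h y0 0 = y0"
| "one_step_seq \<Phi> h y0 (Suc n) = \<Phi> h (one_step_seq \<Phi> h y0 n)"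

definition one_step_well_defined ::
    "real set \<Rightarrow> (real \<times> real) set \<Rightarrow> (real \<Rightarrow> real \<Rightarrow> real) \<Rightarrow> real \<Rightarrow> real \<Rightarrow> nat \<Rightarrow> bool" where
  "one_step_well_defined D U \<Phi> h y0 N \<longleftrightarrow>
     (\<forall>n<N. one_step_seq \<Phi> h y0 n \<in> D \<and> (h, one_step_seq \<Phi> h y0 n) \<in> U)"

definition convergent_one_step_method ::
    "real set \<Rightarrow> (real \<times> real) set \<Rightarrow> (real \<Rightarrow> real \<Rightarrow> real) \<Rightarrow> nat \<Rightarrow> real \<Rightarrow> (real \<Rightarrow> real) \<Rightarrow> bool" where
  "convergent_one_step_method D U \<Phi> p T y \<longleftrightarrow>
     (\<forall>K. compact K \<and> K \<subseteq> D \<and> y ` {0..T} \<subseteq> interior K \<longrightarrow>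
       (\<exists>N0\<ge>1. \<exists>M\<ge>0. \<forall>N\<ge>N0. let h = T / real N; s = one_step_seq \<Phi> h (y 0) in
          one_step_well_defined D U \<Phi> h (y 0) N \<and>
          (\<forall>n\<le>N. s n \<in> interior K) \<and>
          Max ((\<lambda>n. \<bar>y (real n * h) - s n\<bar>) ` {0..N}) \<le> M * h ^ p))"

end

theory Submission
  imports Defs
begin

text \<open>
  Write \<open>F(w,x)\<close> for \<^const>\<open>taylor_rhs\<close>. Between two grid points, \<open>z(s) = x + w(s)\<close> with
  \<open>w' = F(w,x)\<close> is an approximate solution of \<open>z' = f(z)\<close>: its defect is the Taylor remainder
  \<open>f(x + w) - F(w,x)\<close>, which is \<open>O(|w|^(r+1))\<close>, and \<open>|w| = O(h)\<close> during a step of length \<open>h\<close>. Consistency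
  and stability can therefore be treated together. If \<open>L\<close> is a Lipschitz constant of \<open>f\<close> near
  the curve, Gronwall's inequality applied to the difference of \<open>y\<close> and \<open>z\<close> over one step
  (\<open>taylor_step_error\<close>) gives, for the errors \<open>e\<^sub>n\<close> at the grid points,
  \<open>e\<^sub>n\<^sub>+\<^sub>1 \<le> exp(L h) (e\<^sub>n + c h^(r+2))\<close>. By induction
  \<open>e\<^sub>n \<le> exp(L n h) n h c h^(r+1) \<le> exp(L T) T c h^(r+1)\<close>.
  The induction simultaneously keeps the numerical solution in a compact neighbourhood of the
  curve, on which all constants are uniform.

  The step must also exist for a step size that does not depend on the base point. Picard
  iteration (\<open>local_solution_exists\<close>) gives a solution on an interval whose length depends only
  on a bound and a Lipschitz constant of the right-hand side, and these are uniform for \<open>F(.,x)\<close>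
  with \<open>x\<close> in a compact set (\<open>taylor_rhs_bounds_on_compact\<close>). Uniqueness of solutions shows that
  the union of all solution intervals is the unique maximal interval, so the definite description
  and the choice in the definition of the flow denote the intended objects
  (\<open>maximal_flow_maximal_solution\<close>).

  If \<open>f\<close> is a polynomial \<open>p\<close> of degree at most \<open>r\<close> on \<open>D\<close>, then \<open>F(w,x) = p(x + w)\<close> for every
  \<open>w\<close>, even if \<open>x + w\<close> lies outside \<open>D\<close>. The curves \<open>y\<close> and \<open>z\<close> then solve the same equation
  \<open>u' = p(u)\<close>, and uniqueness makes every step exact.
\<close>

section \<open>Gronwall's inequality and uniqueness of solutions\<close>

text \<open>
  Dividing \<open>d\<close> by an exponential would finish the proof at once if \<open>\<bar>d\<bar>\<close> were differentiable. It is
  replaced by the smooth majorant \<open>sqrt (d\<^sup>2 + \<eta>\<^sup>2)\<close>, which satisfies the same differential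
  inequality, and \<open>\<eta>\<close> tends to 0 at the end. With \<open>\<epsilon> = 0\<close> the bound yields uniqueness, with
  positive \<open>\<epsilon>\<close> it measures the effect of a defect. Derivatives are taken at interior points because
  the solution \<open>y\<close> has one-sided derivatives at the ends of its interval.
\<close>

lemma gronwall_affine_bound:
  fixes d d' :: "real \<Rightarrow> real"
  assumes "a \<le> b" "0 \<le> L" "0 \<le> \<epsilon>"
    and cont: "continuous_on {a..b} d"
    and deriv: "\<And>t. a < t \<Longrightarrow> t < b \<Longrightarrow> (d has_real_derivative d' t) (at t)"
    and bound: "\<And>t. a < t \<Longrightarrow> t < b \<Longrightarrow> \<bar>d' t\<bar> \<le> L * \<bar>d t\<bar> + \<epsilon>"
  shows "\<bar>d b\<bar> \<le> exp (L * (b - a)) * (\<bar>d a\<bar> + \<epsilon> * (b - a))"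
proof -
  have approx: "\<bar>d b\<bar> \<le> exp (L * (b - a)) * (\<bar>d a\<bar> + \<eta> + \<epsilon> * (b - a))" if "\<eta> > 0" for \<eta>
  proof -
    define \<phi> where "\<phi> t = sqrt ((d t)\<^sup>2 + \<eta>\<^sup>2)" for t
    define \<psi> where "\<psi> t = exp (- L * (t - a)) * \<phi> t - \<epsilon> * (t - a)" for t
    have \<phi>_pos: "\<phi> t > 0" for t
      using \<open>\<eta> > 0\<close> by (simp add: \<phi>_def add_nonneg_pos)
    have d_le: "\<bar>d t\<bar> \<le> \<phi> t" for t
      unfolding \<phi>_def by (rule real_le_rsqrt) simp
    have "\<psi> b \<le> \<psi> a"
    proof (rule DERIV_nonpos_imp_decreasing_open[OF \<open>a \<le> b\<close>])
      fix t assume t: "a < t" "t < b"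
      let ?e = "exp (- L * (t - a))"
      have pos: "(d t)\<^sup>2 + \<eta>\<^sup>2 > 0" using \<open>\<eta> > 0\<close> by (simp add: add_nonneg_pos)
      have "(\<phi> has_real_derivative d t * d' t / \<phi> t) (at t)"
        unfolding \<phi>_def using pos
        by (auto intro!: derivative_eq_intros deriv[OF t] simp: field_simps)
      then have D: "(\<psi> has_real_derivative ?e * (d t * d' t / \<phi> t - L * \<phi> t) - \<epsilon>) (at t)"
        unfolding \<psi>_def by (auto intro!: derivative_eq_intros simp: algebra_simps)
      have "d t * d' t \<le> \<bar>d t\<bar> * \<bar>d' t\<bar>" by (metis abs_ge_self abs_mult)
      also have "\<dots> \<le> \<phi> t * (L * \<phi> t + \<epsilon>)"
        using bound[OF t] d_le[of t] mult_left_mono[OF d_le[of t] \<open>0 \<le> L\<close>]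
        by (intro mult_mono) (auto intro: order_trans)
      finally have "d t * d' t / \<phi> t \<le> L * \<phi> t + \<epsilon>"
        using \<phi>_pos[of t] by (simp add: pos_divide_le_eq mult.commute)
      then have "?e * (d t * d' t / \<phi> t - L * \<phi> t) \<le> ?e * \<epsilon>" by (intro mult_left_mono) auto
      also have "\<dots> \<le> 1 * \<epsilon>"
        using t assms(2,3) by (intro mult_right_mono) auto
      finally show "\<exists>y. (\<psi> has_real_derivative y) (at t) \<and> y \<le> 0"
        using D by (intro exI conjI) auto
    next
      show "continuous_on {a..b} \<psi>"
        unfolding \<psi>_def \<phi>_def by (intro continuous_intros cont)
    qed
    then have "exp (- L * (b - a)) * \<phi> b \<le> \<phi> a + \<epsilon> * (b - a)"
      by (simp add: \<psi>_def)
    also have "\<phi> a \<le> \<bar>d a\<bar> + \<eta>"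
      unfolding \<phi>_def using sqrt_sum_squares_le_sum_abs[of "d a" \<eta>] \<open>\<eta> > 0\<close> by simp
    finally have "exp (- L * (b - a)) * \<phi> b \<le> \<bar>d a\<bar> + \<eta> + \<epsilon> * (b - a)" by simp
    then have "exp (L * (b - a)) * (exp (- L * (b - a)) * \<phi> b)
        \<le> exp (L * (b - a)) * (\<bar>d a\<bar> + \<eta> + \<epsilon> * (b - a))"
      by (rule mult_left_mono) simp
    moreover have "exp (L * (b - a)) * (exp (- L * (b - a)) * \<phi> b) = \<phi> b"
      by (simp only: mult_minus_left exp_minus) simp
    ultimately show ?thesis using d_le[of b] by linarith
  qed
  have "((\<lambda>\<eta>. exp (L * (b - a)) * (\<bar>d a\<bar> + \<eta> + \<epsilon> * (b - a))) \<longlongrightarrow>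
      exp (L * (b - a)) * (\<bar>d a\<bar> + 0 + \<epsilon> * (b - a))) (at_right 0)"
    by (intro tendsto_intros)
  moreover have "\<forall>\<^sub>F \<eta> in at_right 0. \<bar>d b\<bar> \<le> exp (L * (b - a)) * (\<bar>d a\<bar> + \<eta> + \<epsilon> * (b - a))"
    using approx by (auto simp: eventually_at_right_field intro!: exI[of _ 1])
  ultimately show ?thesis
    using tendsto_lowerbound[OF _ _ trivial_limit_at_right_real] by fastforce
qed

text \<open>
  On the whole line this is local Lipschitz continuity, in the form in which uniqueness uses it:
  two solutions on a compact interval have their values in a common bounded interval.
\<close>

definition lipschitz_on_bounded_intervals :: "(real \<Rightarrow> real) \<Rightarrow> bool" where
  "lipschitz_on_bounded_intervals g \<longleftrightarrow> (\<forall>R. \<exists>L. L-lipschitz_on {-R..R} g)"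

lemma solution_unique_forward:
  assumes lip: "lipschitz_on_bounded_intervals g" and "a \<le> b"
    and cont: "continuous_on {a..b} u" "continuous_on {a..b} v"
    and u': "\<And>t. a < t \<Longrightarrow> t < b \<Longrightarrow> (u has_real_derivative g (u t)) (at t)"
    and v': "\<And>t. a < t \<Longrightarrow> t < b \<Longrightarrow> (v has_real_derivative g (v t)) (at t)"
    and "u a = v a"
  shows "u b = v b"
proof -
  have "bounded (u ` {a..b} \<union> v ` {a..b})"
    using cont by (simp add: compact_continuous_image compact_imp_bounded)
  then obtain R where R: "\<And>x. x \<in> u ` {a..b} \<union> v ` {a..b} \<Longrightarrow> \<bar>x\<bar> \<le> R"
    unfolding bounded_iff real_norm_def by blast
  obtain L where L: "L-lipschitz_on {-R..R} g"
    using lip by (auto simp: lipschitz_on_bounded_intervals_def)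
  have "\<bar>u b - v b\<bar> \<le> exp (L * (b - a)) * (\<bar>u a - v a\<bar> + 0 * (b - a))"
  proof (rule gronwall_affine_bound[where d' = "\<lambda>t. g (u t) - g (v t)"])
    fix t assume t: "a < t" "t < b"
    show "((\<lambda>t. u t - v t) has_real_derivative g (u t) - g (v t)) (at t)"
      by (intro derivative_intros u' v' t)
    have "u t \<in> {-R..R}" "v t \<in> {-R..R}"
      using t R[of "u t"] R[of "v t"] by auto
    then show "\<bar>g (u t) - g (v t)\<bar> \<le> L * \<bar>u t - v t\<bar> + 0"
      using lipschitz_onD[OF L] by (simp add: dist_real_def)
  qed (auto intro!: continuous_intros cont \<open>a \<le> b\<close> lipschitz_on_nonneg[OF L])
  then show ?thesis using \<open>u a = v a\<close> by simp
qed

lemma autonomous_solution_continuous: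
  "autonomous_solution g x0 I u \<Longrightarrow> continuous_on I u"
  unfolding autonomous_solution_def
  by (meson DERIV_isCont continuous_at_imp_continuous_on)

lemma autonomous_solution_closed_segment:
  assumes "autonomous_solution g x0 I u" "t \<in> I" "s \<in> closed_segment 0 t"
  shows "s \<in> I"
  using assms unfolding autonomous_solution_def is_interval_convex_1 
  by (meson closed_segment_subset subsetD)

lemma autonomous_solution_unique:
  assumes lip: "lipschitz_on_bounded_intervals g"
    and u: "autonomous_solution g x0 I u" and v: "autonomous_solution g x0 J v"
    and "t \<in> I" "t \<in> J"
  shows "u t = v t"
proof (cases "t \<ge> 0")
  case True
  have seg: "s \<in> I" "s \<in> J" if "0 \<le> s" "s \<le> t" for s
    using that autonomous_solution_closed_segment[OF u \<open>t \<in> I\<close>]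
      autonomous_solution_closed_segment[OF v \<open>t \<in> J\<close>] True
    by (auto simp: closed_segment_eq_real_ivl)
  show ?thesis
    by (rule solution_unique_forward[OF lip True])
      (use u v seg in \<open>auto simp: autonomous_solution_def
        intro: continuous_on_subset[OF autonomous_solution_continuous[OF u]]
          continuous_on_subset[OF autonomous_solution_continuous[OF v]]\<close>)
next
  case False
  have seg: "-s \<in> I \<and> -s \<in> J" if "s \<in> {0..-t}" for s
    using autonomous_solution_closed_segment[OF u \<open>t \<in> I\<close>, of "-s"]
      autonomous_solution_closed_segment[OF v \<open>t \<in> J\<close>, of "-s"] False that
    by (auto simp: closed_segment_eq_real_ivl)
  have lip': "lipschitz_on_bounded_intervals (\<lambda>x. - g x)"
    using lip by (simp add: lipschitz_on_bounded_intervals_def)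
  \<comment> \<open>Reversing time turns solutions for \<open>g\<close> into solutions for \<open>-g\<close>, so the forward case applies.\<close>
  have refl_deriv: "((\<lambda>s. w (- s)) has_real_derivative - g (w (- s))) (at s)"
    if "(w has_real_derivative g (w (- s))) (at (- s))" for w s
    using that DERIV_mirror[of w "g (w (-s))" s] by simp
  have "u (- (- t)) = v (- (- t))"
  proof (rule solution_unique_forward[OF lip', where a = 0 and b = "-t"
        and u = "\<lambda>s. u (- s)" and v = "\<lambda>s. v (- s)"])
    show "continuous_on {0..-t} (\<lambda>s. u (- s))" "continuous_on {0..-t} (\<lambda>s. v (- s))"
      using seg
      by (auto intro!: continuous_on_compose2[OF autonomous_solution_continuous[OF u]]
          continuous_on_compose2[OF autonomous_solution_continuous[OF v]] continuous_intros)
  qed (use u v seg False in \<open>auto simp: autonomous_solution_def intro!: refl_deriv\<close>)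
  then show ?thesis by simp
qed

section \<open>Local existence and the maximal flow\<close>

text \<open>
  Picard iteration. Composing \<open>g\<close> with the projection onto \<open>cball x0 \<rho>\<close> makes it bounded and
  Lipschitz on the whole line, so the integral operator is a contraction of the complete space of
  all bounded continuous functions. Its fixed point moves at
  speed at most \<open>B\<close>, hence stays in the ball where the projection is the identity. The length \<open>a\<close>
  depends only on \<open>\<rho>\<close>, \<open>B\<close> and \<open>L\<close>, which later gives a step size valid for all base points.
\<close>

lemma local_solution_exists:
  fixes g :: "real \<Rightarrow> real"
  assumes lip: "L-lipschitz_on (cball x0 \<rho>) g"
    and bound: "\<And>x. x \<in> cball x0 \<rho> \<Longrightarrow> \<bar>g x\<bar> \<le> B"
    and "\<rho> > 0" "a > 0" "B * a \<le> \<rho>" "L * a < 1"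
  obtains u where "autonomous_solution g x0 {-a<..<a} u"
    "\<And>t. t \<in> {-a<..<a} \<Longrightarrow> \<bar>u t - x0\<bar> \<le> B * \<bar>t\<bar>"
proof -
  \<comment> \<open>\<open>c\<close> projects values to the ball and \<open>k\<close> projects times to \<open>{-a..a}\<close>, so that the iterates are
      defined and bounded on the whole line.\<close>
  define c where "c w = max (x0 - \<rho>) (min (x0 + \<rho>) w)" for w
  define g' where "g' w = g (c w)" for w
  define k where "k t = max (-a) (min a t)" for t
  have c_mem: "c w \<in> cball x0 \<rho>" for w
    using \<open>\<rho> > 0\<close> by (auto simp: c_def dist_real_def)
  have k_mem: "k t \<in> {-a..a}" for t using \<open>a > 0\<close> by (auto simp: k_def)
  have g'_bound: "\<bar>g' w\<bar> \<le> B" for w unfolding g'_def by (intro bound c_mem)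
  have c_lip: "\<bar>c w - c v\<bar> \<le> \<bar>w - v\<bar>" for v w by (auto simp: c_def)
  have L0: "L \<ge> 0" by (rule lipschitz_on_nonneg[OF lip])
  have g'_lip: "\<bar>g' w - g' v\<bar> \<le> L * \<bar>w - v\<bar>" for v w
    using lipschitz_onD[OF lip c_mem c_mem, of w v] mult_left_mono[OF c_lip L0, of w v]
    by (simp add: g'_def dist_real_def)
  have g'_cont: "continuous_on UNIV g'"
    by (rule lipschitz_on_continuous_on[where L = L], rule lipschitz_onI)
      (use g'_lip L0 in \<open>auto simp: dist_real_def\<close>)
  \<comment> \<open>The primitive vanishing at 0. The integral from 0 to \<open>t\<close> would be 0 for negative \<open>t\<close>, because
      \<^term>\<open>{0..t}\<close> is then empty; starting at \<open>-a\<close> avoids this.\<close>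
  define prim where
    "prim \<phi> t = integral {-a..t} \<phi> - integral {-a..0} \<phi>" for \<phi> :: "real \<Rightarrow> real" and t
  have prim_deriv: "(prim \<phi> has_real_derivative \<phi> t) (at t within {-a..a})"
    if "continuous_on UNIV \<phi>" "t \<in> {-a..a}" for \<phi> t
    unfolding prim_def
    using DERIV_diff[OF integral_has_real_derivative DERIV_const, of "-a" a \<phi> t "integral {-a..0} \<phi>"]
      continuous_on_subset[OF that(1)] that(2) by auto
  have prim_0: "prim \<phi> 0 = 0" for \<phi> by (simp add: prim_def)
  have g'u_cont: "continuous_on UNIV (\<lambda>t. g' (apply_bcontfun u t))" for u :: "real \<Rightarrow>\<^sub>C real"
    by (rule continuous_on_compose2[OF g'_cont]) auto
  have prim_bound: "\<bar>prim \<phi> t\<bar> \<le> C * \<bar>t\<bar>"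
    if "continuous_on UNIV \<phi>" "\<And>s. \<bar>\<phi> s\<bar> \<le> C" "t \<in> {-a..a}" for \<phi> C t
    using field_differentiable_bound[of "{-a..a}" "prim \<phi>" \<phi> C t 0] prim_deriv[OF that(1)]
      that \<open>a > 0\<close> by (auto simp: prim_0)
  define P where "P u = Bcontfun (\<lambda>t. x0 + prim (\<lambda>s. g' (apply_bcontfun u s)) (k t))"
    for u :: "real \<Rightarrow>\<^sub>C real"
  have P_in: "(\<lambda>t. x0 + prim (\<lambda>s. g' (apply_bcontfun u s)) (k t)) \<in> bcontfun" for u
  proof (rule bcontfun_normI[where b = "\<bar>x0\<bar> + B * a"])
    have "continuous_on {-a..a} (prim (\<lambda>s. g' (apply_bcontfun u s)))"
      using prim_deriv[OF g'u_cont]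
      by (meson DERIV_continuous continuous_on_eq_continuous_within)
    moreover have "continuous_on UNIV k"
      unfolding k_def by (intro continuous_intros)
    ultimately show "continuous_on UNIV (\<lambda>t. x0 + prim (\<lambda>s. g' (apply_bcontfun u s)) (k t))"
      using k_mem by (intro continuous_on_add continuous_on_const)
        (rule continuous_on_compose2[of "{-a..a}"], auto)
    fix t
    have "\<bar>prim (\<lambda>s. g' (apply_bcontfun u s)) (k t)\<bar> \<le> B * \<bar>k t\<bar>"
      by (rule prim_bound[OF g'u_cont g'_bound k_mem])
    also have "\<dots> \<le> B * a"
      using k_mem[of t] order_trans[OF abs_ge_zero g'_bound] by (intro mult_left_mono) auto
    finally show "norm (x0 + prim (\<lambda>s. g' (apply_bcontfun u s)) (k t)) \<le> \<bar>x0\<bar> + B * a"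
      by auto
  qed
  have P_apply: "apply_bcontfun (P u) t = x0 + prim (\<lambda>s. g' (apply_bcontfun u s)) (k t)" for u t
    unfolding P_def by (simp add: Bcontfun_inverse[OF P_in])
  have "\<exists>!u. P u = u"
  proof (rule banach_fix_type[of "L * a"], intro L0 mult_nonneg_nonneg less_imp_le \<open>a > 0\<close>)
    show "\<forall>u v. dist (P u) (P v) \<le> L * a * dist u v"
    proof (intro allI dist_bound)
      fix u v :: "real \<Rightarrow>\<^sub>C real" and t
      let ?\<phi> = "\<lambda>s. g' (apply_bcontfun u s)" and ?\<chi> = "\<lambda>s. g' (apply_bcontfun v s)"
      have "\<bar>?\<phi> s - ?\<chi> s\<bar> \<le> L * dist u v" for s
        using g'_lip[of "apply_bcontfun u s" "apply_bcontfun v s"]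
          mult_left_mono[OF dist_bounded[of u s v] L0] by (simp add: dist_real_def)
      then have "\<bar>(prim ?\<phi> (k t) - prim ?\<chi> (k t)) - (prim ?\<phi> 0 - prim ?\<chi> 0)\<bar>
          \<le> L * dist u v * \<bar>k t - 0\<bar>"
        using field_differentiable_bound[of "{-a..a}" "\<lambda>t. prim ?\<phi> t - prim ?\<chi> t"
            "\<lambda>t. ?\<phi> t - ?\<chi> t" "L * dist u v" "k t" 0] \<open>a > 0\<close> k_mem[of t]
          DERIV_diff[OF prim_deriv[OF g'u_cont] prim_deriv[OF g'u_cont]] by auto
      also have "\<dots> \<le> L * dist u v * a"
        using k_mem[of t] L0 by (intro mult_left_mono) auto
      finally show "dist (apply_bcontfun (P u) t) (apply_bcontfun (P v) t) \<le> L * a * dist u v"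
        by (simp add: P_apply dist_real_def prim_0 ac_simps)
    qed
  qed (use \<open>L * a < 1\<close> in auto)
  then obtain u where u: "P u = u" by blast
  let ?u = "apply_bcontfun u"
  have u_eq: "?u t = x0 + prim (\<lambda>s. g' (?u s)) t" if "t \<in> {-a..a}" for t
    using P_apply[of u t] that by (simp add: u k_def)
  have u_bound: "\<bar>?u t - x0\<bar> \<le> B * \<bar>t\<bar>" if "t \<in> {-a<..<a}" for t
    using prim_bound[OF g'u_cont g'_bound, of t u] u_eq[of t] that by auto
  have u_deriv: "(?u has_real_derivative g (?u t)) (at t)" if t: "t \<in> {-a<..<a}" for t
  proof -
    have "((\<lambda>t. x0 + prim (\<lambda>s. g' (?u s)) t) has_real_derivative g' (?u t)) (at t within {-a..a})"
      using prim_deriv[OF g'u_cont, of t u] t by (auto intro!: derivative_eq_intros)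
    then have "(?u has_real_derivative g' (?u t)) (at t within {-a..a})"
      by (rule has_field_derivative_transform_within[OF _ zero_less_one]) (use t u_eq in auto)
    moreover have "at t within {-a..a} = at t"
      using t by (intro at_within_interior) (auto simp: interior_atLeastAtMost_real)
    moreover have "B * \<bar>t\<bar> \<le> B * a"
      using t order_trans[OF abs_ge_zero g'_bound] by (intro mult_left_mono) auto
    then have "c (?u t) = ?u t"
      using u_bound[OF t] \<open>B * a \<le> \<rho>\<close> by (auto simp: c_def)
    ultimately show ?thesis by (simp add: g'_def)
  qed
  have "autonomous_solution g x0 {-a<..<a} ?u"
    unfolding autonomous_solution_def using \<open>a > 0\<close> u_deriv u_eq[of 0]
    by (auto simp: is_interval_convex_1 prim_0)
  then show thesis using that u_bound by blast
qed

lemma autonomous_solution_exists: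
  assumes lip: "lipschitz_on_bounded_intervals g"
  shows "\<exists>I u. autonomous_solution g x0 I u"
proof -
  obtain L where "L-lipschitz_on {-(\<bar>x0\<bar> + 1)..\<bar>x0\<bar> + 1} g"
    using lip unfolding lipschitz_on_bounded_intervals_def by blast
  then have L: "L-lipschitz_on (cball x0 1) g"
    by (rule lipschitz_on_subset) (auto simp: dist_real_def)
  have "bounded (g ` cball x0 1)"
    by (intro compact_imp_bounded compact_continuous_image lipschitz_on_continuous_on[OF L]) simp
  then obtain B where B: "B > 0" "\<And>x. x \<in> cball x0 1 \<Longrightarrow> \<bar>g x\<bar> \<le> B"
    unfolding bounded_pos by auto
  have L0: "L \<ge> 0" by (rule lipschitz_on_nonneg[OF L])
  define a where "a = min (1 / B) (1 / (L + 1))"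
  have "a > 0" using B(1) L0 by (simp add: a_def)
  have "B * a \<le> B * (1 / B)" "L * a \<le> L * (1 / (L + 1))"
    using B(1) L0 by (intro mult_left_mono; simp add: a_def)+
  moreover have "L * (1 / (L + 1)) < 1" using L0 by simp
  ultimately show ?thesis
    using local_solution_exists[OF L B(2), of a] \<open>a > 0\<close> B(1) by fastforce
qed

text \<open>
  By uniqueness all solutions agree where they are defined, so they glue to a solution on the
  union of their intervals, which is connected because 0 lies in each of them. A solution that
  admits no proper extension must already be defined on this union.
\<close>

lemma maximal_solution_ex1:
  assumes lip: "lipschitz_on_bounded_intervals g"
  shows "\<exists>!I. \<exists>u. maximal_solution g x0 I u"
proof -
  define S where "S = {(I, u). autonomous_solution g x0 I u}"
  define M where "M = (\<Union>(I, u)\<in>S. I)"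
  define w where "w t = snd (SOME p. p \<in> S \<and> t \<in> fst p) t" for t
  have w_eq: "w t = u t" if "autonomous_solution g x0 I u" "t \<in> I" for I u t
  proof -
    have "\<exists>p. p \<in> S \<and> t \<in> fst p" using that by (intro exI[of _ "(I, u)"]) (auto simp: S_def)
    from someI_ex[OF this] show ?thesis
      unfolding w_def S_def using autonomous_solution_unique[OF lip _ that(1) _ that(2)] by auto
  qed
  have sub_M: "I \<subseteq> M" if "autonomous_solution g x0 I u" for I u
    using that by (auto simp: M_def S_def)
  have "autonomous_solution g x0 M w"
    unfolding autonomous_solution_def
  proof (intro conjI ballI)
    obtain I u where Iu: "autonomous_solution g x0 I u"
      using autonomous_solution_exists[OF lip] by blast
    then have "0 \<in> I" "u 0 = x0" by (auto simp: autonomous_solution_def)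
    then show "0 \<in> M" "w 0 = x0" using sub_M[OF Iu] w_eq[OF Iu] by auto
    show "open M" by (auto simp: M_def S_def autonomous_solution_def)
    have "connected M"
      unfolding M_def
    proof (rule connected_Union)
      show "\<Inter> ((\<lambda>(I, u). I) ` S) \<noteq> {}"
        by (auto simp: S_def autonomous_solution_def intro!: exI[of _ 0])
    qed (auto simp: S_def autonomous_solution_def is_interval_connected_1)
    then show "is_interval M" by (simp add: is_interval_connected_1)
    fix t assume "t \<in> M"
    then obtain I u where I: "autonomous_solution g x0 I u" "t \<in> I"
      by (auto simp: M_def S_def)
    then have "open I" "(u has_real_derivative g (u t)) (at t)"
      by (auto simp: autonomous_solution_def)
    then show "(w has_real_derivative g (w t)) (at t)"
      using w_eq[OF I(1)] I(2) by (simp add: has_field_derivative_transform_within_open[of u _ t I])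
  qed
  note sol = this
  have max: "maximal_solution g x0 M w"
    unfolding maximal_solution_def using sol sub_M by blast
  moreover have "I = M" if "maximal_solution g x0 I u" for I u
  proof -
    have "autonomous_solution g x0 I u" using that by (simp add: maximal_solution_def)
    then have "I \<subseteq> M" "\<forall>t\<in>I. w t = u t" using sub_M w_eq by auto
    then show ?thesis using that sol unfolding maximal_solution_def by blast
  qed
  ultimately show ?thesis by blast
qed

lemma maximal_flow_maximal_solution:
  assumes "lipschitz_on_bounded_intervals g"
  shows "maximal_solution g x0 (maximal_interval g x0) (maximal_flow g x0)"
proof -
  have "\<exists>u. maximal_solution g x0 (maximal_interval g x0) u"
    unfolding maximal_interval_def by (rule theI'[OF maximal_solution_ex1[OF assms]])
  then show ?thesis unfolding maximal_flow_def by (rule someI_ex)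
qed

lemma maximal_flow_solution:
  assumes "lipschitz_on_bounded_intervals g"
  shows "autonomous_solution g x0 (maximal_interval g x0) (maximal_flow g x0)"
  using maximal_flow_maximal_solution[OF assms] by (simp add: maximal_solution_def)

text \<open>
  Maximality in the definition is only the absence of a proper extension. Gluing an arbitrary
  solution to the maximal flow turns it into dominance over all solutions; this is how a given
  time is shown to lie in the maximal interval.
\<close>

lemma solution_subset_maximal_interval:
  assumes lip: "lipschitz_on_bounded_intervals g" and u: "autonomous_solution g x0 I u"
  shows "I \<subseteq> maximal_interval g x0"
proof -
  let ?J = "maximal_interval g x0" and ?v = "maximal_flow g x0"
  have v: "autonomous_solution g x0 ?J ?v" by (rule maximal_flow_solution[OF lip])
  define w where "w t = (if t \<in> I then u t else ?v t)" for t
  have w_v: "w t = ?v t" if "t \<in> ?J" for t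
    using autonomous_solution_unique[OF lip u v _ that] by (auto simp: w_def)
  have "autonomous_solution g x0 (I \<union> ?J) w"
    unfolding autonomous_solution_def
  proof (intro conjI ballI)
    have "connected (I \<union> ?J)"
      using u v by (intro connected_Un) (auto simp: autonomous_solution_def is_interval_connected_1)
    then show "is_interval (I \<union> ?J)" by (simp add: is_interval_connected_1)
    fix t assume "t \<in> I \<union> ?J"
    then show "(w has_real_derivative g (w t)) (at t)"
    proof
      assume "t \<in> I"
      with u have "open I" "(u has_real_derivative g (u t)) (at t)"
        by (auto simp: autonomous_solution_def)
      then show ?thesis
        using \<open>t \<in> I\<close> by (simp add: w_def has_field_derivative_transform_within_open[of u _ t I])
    next
      assume "t \<in> ?J"
      with v have "open ?J" "(?v has_real_derivative g (?v t)) (at t)"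
        by (auto simp: autonomous_solution_def)
      then show ?thesis
        using \<open>t \<in> ?J\<close> w_v by (simp add: has_field_derivative_transform_within_open[of ?v _ t ?J])
    qed
  qed (use u v in \<open>auto simp: autonomous_solution_def w_def\<close>)
  then have "I \<union> ?J = ?J"
    using maximal_flow_maximal_solution[OF lip, of x0] w_v unfolding maximal_solution_def
    by (metis Un_upper2)
  then show ?thesis by blast
qed

section \<open>Taylor polynomials as right-hand sides\<close>

lemma iterated_deriv_has_derivative:
  assumes "open D" "continuously_differentiable_times_on k f D" "j < k" "x \<in> D"
  shows "((deriv ^^ j) f has_real_derivative (deriv ^^ Suc j) f x) (at x)"
proof -
  have "(deriv ^^ j) f differentiable at x"
    using assms unfolding continuously_differentiable_times_on_def differentiable_on_def
    by (metis at_within_open)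
  then show ?thesis
    by (simp add: DERIV_deriv_iff_real_differentiable)
qed

lemma iterated_deriv_continuous_on:
  assumes "open D" "continuously_differentiable_times_on k f D" "j \<le> k"
  shows "continuous_on D ((deriv ^^ j) f)"
proof (cases "j = k")
  case False
  then show ?thesis
    using assms iterated_deriv_has_derivative[OF assms(1,2), of j]
    by (intro continuous_at_imp_continuous_on) (auto intro: DERIV_isCont)
qed (use assms in \<open>simp add: continuously_differentiable_times_on_def\<close>)

lemma lipschitz_on_interval_if_C1:
  fixes g g' :: "real \<Rightarrow> real"
  assumes "\<And>x. x \<in> {a..b} \<Longrightarrow> (g has_real_derivative g' x) (at x)" "continuous_on {a..b} g'"
  obtains L where "L-lipschitz_on {a..b} g"
proof -
  have "bounded (g' ` {a..b})"
    using assms(2) by (simp add: compact_continuous_image compact_imp_bounded)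
  then obtain L where L: "L > 0" "\<And>x. x \<in> {a..b} \<Longrightarrow> \<bar>g' x\<bar> \<le> L"
    unfolding bounded_pos by auto
  have "L-lipschitz_on {a..b} g"
  proof (rule lipschitz_onI)
    fix x z assume "x \<in> {a..b}" "z \<in> {a..b}"
    then show "dist (g x) (g z) \<le> L * dist x z"
      using field_differentiable_bound[of "{a..b}" g g' L x z] L(2)
        has_field_derivative_at_within[OF assms(1)] by (auto simp: dist_real_def)
  qed (use L in simp)
  then show thesis by (rule that)
qed

lemma poly_lipschitz_on_bounded_intervals:
  "lipschitz_on_bounded_intervals (poly p)"
  unfolding lipschitz_on_bounded_intervals_def
  by (metis lipschitz_on_interval_if_C1 poly_DERIV continuous_on_poly continuous_on_id)

lemma taylor_rhs_lipschitz_on_bounded_intervals: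
  "lipschitz_on_bounded_intervals (\<lambda>w. taylor_rhs r f w x)"
proof -
  have "(\<lambda>w. taylor_rhs r f w x) = poly (\<Sum>j\<le>r. monom ((deriv ^^ j) f x / fact j) j)"
    by (auto simp: taylor_rhs_def poly_sum poly_monom)
  then show ?thesis by (simp add: poly_lipschitz_on_bounded_intervals)
qed

text \<open>
  The coefficients of the Taylor polynomial are continuous in the base point, so a single bound
  \<open>A\<close> serves for all of them on \<open>J\<close>; the powers of \<open>w\<close> are handled on the unit ball, where
  \<open>w ^ j\<close> is bounded by 1 and has Lipschitz constant \<open>j\<close>.
\<close>

lemma taylor_rhs_bounds_on_compact:
  assumes "open D" "continuously_differentiable_times_on r f D" "compact J" "J \<subseteq> D"
  obtains B L where "B > 0"
    "\<And>x w. x \<in> J \<Longrightarrow> \<bar>w\<bar> \<le> 1 \<Longrightarrow> \<bar>taylor_rhs r f w x\<bar> \<le> B"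
    "\<And>x. x \<in> J \<Longrightarrow> L-lipschitz_on (cball 0 1) (\<lambda>w. taylor_rhs r f w x)"
proof -
  have "bounded (\<Union>j\<le>r. (\<lambda>x. (deriv ^^ j) f x / fact j) ` J)"
  proof (intro bounded_UN ballI compact_imp_bounded compact_continuous_image \<open>compact J\<close>)
    fix j assume "j \<in> {..r}"
    then show "continuous_on J (\<lambda>x. (deriv ^^ j) f x / fact j)"
      using iterated_deriv_continuous_on[OF assms(1,2), of j] \<open>J \<subseteq> D\<close>
      by (intro continuous_intros) (auto intro: continuous_on_subset)
  qed simp
  then obtain A where A: "A > 0"
    "\<And>x j. x \<in> J \<Longrightarrow> j \<le> r \<Longrightarrow> \<bar>(deriv ^^ j) f x / fact j\<bar> \<le> A"
    unfolding bounded_pos by fastforce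
  have "\<bar>taylor_rhs r f w x\<bar> \<le> (\<Sum>j\<le>r. A)" if "x \<in> J" "\<bar>w\<bar> \<le> 1" for x w
    unfolding taylor_rhs_def
  proof (intro order_trans[OF sum_abs] sum_mono)
    fix j assume "j \<in> {..r}"
    then have "\<bar>(deriv ^^ j) f x / fact j\<bar> * \<bar>w ^ j\<bar> \<le> A * 1"
      using A that by (intro mult_mono) (auto simp: power_abs power_le_one)
    then show "\<bar>(deriv ^^ j) f x / fact j * w ^ j\<bar> \<le> A" by (simp add: abs_mult)
  qed
  moreover have "(\<Sum>j\<le>r. A) > 0" using A(1) by simp
  moreover have "(\<Sum>j\<le>r. A * real j)-lipschitz_on (cball 0 1) (\<lambda>w. taylor_rhs r f w x)"
    if "x \<in> J" for x
  proof (rule lipschitz_onI)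
    show "(\<Sum>j\<le>r. A * real j) \<ge> 0" using A(1) by (intro sum_nonneg) auto
    fix v w :: real assume vw: "v \<in> cball 0 1" "w \<in> cball 0 1"
    have "\<bar>taylor_rhs r f v x - taylor_rhs r f w x\<bar>
        = \<bar>\<Sum>j\<le>r. (deriv ^^ j) f x / fact j * (v ^ j - w ^ j)\<bar>"
      by (simp add: taylor_rhs_def sum_subtractf[symmetric] right_diff_distrib)
    also have "\<dots> \<le> (\<Sum>j\<le>r. A * real j * \<bar>v - w\<bar>)"
    proof (intro order_trans[OF sum_abs] sum_mono)
      fix j assume "j \<in> {..r}"
      then have "\<bar>(deriv ^^ j) f x / fact j\<bar> * \<bar>v ^ j - w ^ j\<bar> \<le> A * (real j * \<bar>v - w\<bar>)"
        using A that vw norm_power_diff[of v w j] by (intro mult_mono) auto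
      then show "\<bar>(deriv ^^ j) f x / fact j * (v ^ j - w ^ j)\<bar> \<le> A * real j * \<bar>v - w\<bar>"
        by (simp add: abs_mult mult.assoc)
    qed
    finally show "dist (taylor_rhs r f v x) (taylor_rhs r f w x) \<le> (\<Sum>j\<le>r. A * real j) * dist v w"
      by (simp add: dist_real_def sum_distrib_right)
  qed
  ultimately show thesis using that by blast
qed

lemma taylor_remainder_bound:
  assumes "open D" "continuously_differentiable_times_on (r + 1) f D" "{a..b} \<subseteq> D"
    and C: "\<And>t. t \<in> {a..b} \<Longrightarrow> \<bar>(deriv ^^ (r + 1)) f t\<bar> \<le> C"
    and xz: "x \<in> {a..b}" "z \<in> {a..b}"
  shows "\<bar>f z - taylor_rhs r f (z - x) x\<bar> \<le> C / fact (r + 1) * \<bar>z - x\<bar> ^ (r + 1)"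
proof (cases "z = x")
  case True
  have "taylor_rhs r f 0 x = f x"
    by (simp add: taylor_rhs_def power_0_left if_distrib sum.delta cong: if_cong)
  then show ?thesis using True by simp
next
  case False
  have "\<exists>t. (if z < x then z < t \<and> t < x else x < t \<and> t < z) \<and>
      f z = (\<Sum>m<r + 1. (deriv ^^ m) f x / fact m * (z - x) ^ m)
        + (deriv ^^ (r + 1)) f t / fact (r + 1) * (z - x) ^ (r + 1)"
    by (rule Taylor[where a = a and b = b])
      (use assms(3) xz False in \<open>auto intro!: iterated_deriv_has_derivative[OF assms(1,2)]
        simp del: funpow.simps\<close>)
  then obtain t where t_between: "if z < x then z < t \<and> t < x else x < t \<and> t < z"
    and "f z = (\<Sum>m<r + 1. (deriv ^^ m) f x / fact m * (z - x) ^ m)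
        + (deriv ^^ (r + 1)) f t / fact (r + 1) * (z - x) ^ (r + 1)"
    by blast
  then have t: "f z - taylor_rhs r f (z - x) x
      = (deriv ^^ (r + 1)) f t / fact (r + 1) * (z - x) ^ (r + 1)"
    unfolding taylor_rhs_def Suc_eq_plus1[symmetric] lessThan_Suc_atMost by linarith
  have "t \<in> {a..b}" using t_between xz by (auto split: if_splits)
  have "\<bar>(deriv ^^ (r + 1)) f t / fact (r + 1) * (z - x) ^ (r + 1)\<bar>
      \<le> C / fact (r + 1) * \<bar>z - x\<bar> ^ (r + 1)"
    unfolding abs_mult power_abs
    using C[OF \<open>t \<in> {a..b}\<close>]
    by (intro mult_right_mono) (auto simp: abs_divide divide_right_mono simp del: funpow.simps fact_Suc)
  then show ?thesis by (simp only: t)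
qed

section \<open>Error of a single step\<close>

lemma taylor_flow_on_short_interval:
  assumes lip: "L-lipschitz_on (cball 0 \<rho>) (\<lambda>w. taylor_rhs r f w x)"
    and bound: "\<And>w. w \<in> cball 0 \<rho> \<Longrightarrow> \<bar>taylor_rhs r f w x\<bar> \<le> B"
    and "\<rho> > 0" "a > 0" "B * a \<le> \<rho>" "L * a < 1" and t: "\<bar>t\<bar> < a"
  shows "t \<in> maximal_interval (\<lambda>w. taylor_rhs r f w x) 0"
    and "\<bar>maximal_flow (\<lambda>w. taylor_rhs r f w x) 0 t\<bar> \<le> B * \<bar>t\<bar>"
proof -
  note lips = taylor_rhs_lipschitz_on_bounded_intervals[of r f x]
  obtain u where u: "autonomous_solution (\<lambda>w. taylor_rhs r f w x) 0 {-a<..<a} u"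
    "\<And>t. t \<in> {-a<..<a} \<Longrightarrow> \<bar>u t - 0\<bar> \<le> B * \<bar>t\<bar>"
    using local_solution_exists[OF lip bound \<open>\<rho> > 0\<close> \<open>a > 0\<close> \<open>B * a \<le> \<rho>\<close> \<open>L * a < 1\<close>]
    by blast
  have t_mem: "t \<in> {-a<..<a}" using t by auto
  show max: "t \<in> maximal_interval (\<lambda>w. taylor_rhs r f w x) 0"
    using solution_subset_maximal_interval[OF lips u(1)] t_mem by blast
  show "\<bar>maximal_flow (\<lambda>w. taylor_rhs r f w x) 0 t\<bar> \<le> B * \<bar>t\<bar>"
    using autonomous_solution_unique[OF lips u(1) maximal_flow_solution[OF lips] t_mem max]
      u(2)[OF t_mem] by simp
qed

text \<open>
  The numerical curve \<open>x + w s\<close> satisfies the equation of \<open>u\<close> up to the Taylor remainder, whose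
  size is governed by \<open>\<bar>w s\<bar> \<le> B h\<close>. Gronwall's inequality therefore bounds at once how the
  initial error \<open>\<bar>u t - x\<bar>\<close> is propagated and how much error is newly committed.
\<close>

lemma taylor_step_error:
  assumes lip: "L-lipschitz_on J f"
    and rem: "\<And>x z. x \<in> J \<Longrightarrow> z \<in> J \<Longrightarrow>
      \<bar>f z - taylor_rhs r f (z - x) x\<bar> \<le> C * \<bar>z - x\<bar> ^ (r + 1)"
    and "0 \<le> C" "0 \<le> B" "0 \<le> h" "x \<in> J"
    and w0: "w 0 = 0"
    and w': "\<And>s. s \<in> {0..h} \<Longrightarrow> (w has_real_derivative taylor_rhs r f (w s) x) (at s)"
    and w_bound: "\<And>s. s \<in> {0..h} \<Longrightarrow> \<bar>w s\<bar> \<le> B * s"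
    and w_J: "\<And>s. s \<in> {0..h} \<Longrightarrow> x + w s \<in> J"
    and u_cont: "continuous_on {t..t + h} u"
    and u': "\<And>s. t < s \<Longrightarrow> s < t + h \<Longrightarrow> (u has_real_derivative f (u s)) (at s)"
    and u_J: "\<And>s. s \<in> {t..t + h} \<Longrightarrow> u s \<in> J"
  shows "\<bar>u (t + h) - (x + w h)\<bar> \<le> exp (L * h) * (\<bar>u t - x\<bar> + C * (B * h) ^ (r + 1) * h)"
proof -
  have "\<bar>u (t + h) - (x + w h)\<bar>
      \<le> exp (L * (h - 0)) * (\<bar>u (t + 0) - (x + w 0)\<bar> + C * (B * h) ^ (r + 1) * (h - 0))"
  proof (rule gronwall_affine_bound[where d = "\<lambda>s. u (t + s) - (x + w s)"
        and d' = "\<lambda>s. f (u (t + s)) - taylor_rhs r f (w s) x"])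
    have "continuous_on {0..h} w"
      using w' by (meson DERIV_isCont continuous_at_imp_continuous_on)
    then show "continuous_on {0..h} (\<lambda>s. u (t + s) - (x + w s))"
      by (auto intro!: continuous_intros continuous_on_compose2[OF u_cont])
    fix s assume s: "0 < s" "s < h"
    then have "((\<lambda>s. u (t + s)) has_real_derivative f (u (t + s))) (at s)"
      using u'[of "t + s"] by (simp add: DERIV_shift[symmetric] add.commute)
    then show "((\<lambda>s. u (t + s) - (x + w s)) has_real_derivative
        f (u (t + s)) - taylor_rhs r f (w s) x) (at s)"
      using w'[of s] s by (auto intro!: derivative_eq_intros)
    have "\<bar>f (u (t + s)) - f (x + w s)\<bar> \<le> L * \<bar>u (t + s) - (x + w s)\<bar>"
      using lipschitz_onD[OF lip u_J w_J, of "t + s" s] s by (simp add: dist_real_def)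
    moreover have "\<bar>f (x + w s) - taylor_rhs r f (w s) x\<bar> \<le> C * \<bar>w s\<bar> ^ (r + 1)"
      using rem[OF \<open>x \<in> J\<close> w_J[of s]] s by simp
    moreover have "\<bar>w s\<bar> \<le> B * h"
      using w_bound[of s] s mult_left_mono[of s h B] \<open>0 \<le> B\<close> by auto
    then have "C * \<bar>w s\<bar> ^ (r + 1) \<le> C * (B * h) ^ (r + 1)"
      using \<open>0 \<le> C\<close> by (intro mult_left_mono power_mono) auto
    ultimately show "\<bar>f (u (t + s)) - taylor_rhs r f (w s) x\<bar>
        \<le> L * \<bar>u (t + s) - (x + w s)\<bar> + C * (B * h) ^ (r + 1)" by linarith
  qed (use assms in \<open>auto intro: lipschitz_on_nonneg\<close>)
  then show ?thesis by (simp add: w0)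
qed

lemma closed_interval_solution_interior_derivative:
  fixes y :: "real \<Rightarrow> real"
  assumes "\<forall>t\<in>{0..T}. (y has_real_derivative f (y t)) (at t within {0..T})" "0 < t" "t < T"
  shows "(y has_real_derivative f (y t)) (at t)"
proof -
  have "at t within {0..T} = at t"
    using assms(2,3) by (intro at_within_interior) (simp add: interior_atLeastAtMost_real)
  then show ?thesis using assms by (metis atLeastAtMost_iff less_imp_le)
qed

section \<open>Convergence\<close>

text \<open>
  The neighbourhood is an interval, not just a compact set, because both Taylor's theorem and the
  mean value theorem need convexity. The margin is \<open>2 * \<rho>\<close>: one \<open>\<rho>\<close> for the accumulated error at
  a grid point, one for the motion during the next step. The bound \<open>\<rho> \<le> 1\<close> keeps the increments
  in the unit ball.
\<close>

lemma interval_around_curve: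
  fixes y :: "real \<Rightarrow> real"
  assumes "T > 0" "continuous_on {0..T} y" "open S" "y ` {0..T} \<subseteq> S"
  obtains a b \<rho> where "0 < \<rho>" "\<rho> \<le> 1" "{a..b} \<subseteq> S"
    "\<And>t v. t \<in> {0..T} \<Longrightarrow> \<bar>v - y t\<bar> \<le> 2 * \<rho> \<Longrightarrow> v \<in> {a..b}"
proof -
  obtain c d where cd: "y ` {0..T} = {c..d}" "c \<le> d"
    using continuous_image_closed_interval[of 0 T y] assms by auto
  obtain \<epsilon> where \<epsilon>: "\<epsilon> > 0" "(\<Union>x\<in>{c..d}. cball x \<epsilon>) \<subseteq> S"
    using compact_subset_open_imp_cball_epsilon_subset[of "{c..d}" S] assms cd by auto
  define \<rho> where "\<rho> = min 1 (\<epsilon> / 2)"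
  have "{c - 2 * \<rho>..d + 2 * \<rho>} \<subseteq> S"
  proof
    fix v assume v: "v \<in> {c - 2 * \<rho>..d + 2 * \<rho>}"
    have "\<bar>max c (min d v) - v\<bar> \<le> \<epsilon>" "max c (min d v) \<in> {c..d}"
      using v cd(2) \<epsilon>(1) by (auto simp: \<rho>_def)
    then have "v \<in> cball (max c (min d v)) \<epsilon>" by (simp add: dist_real_def)
    then show "v \<in> S" using \<epsilon>(2) \<open>max c (min d v) \<in> {c..d}\<close> by blast
  qed
  moreover have "v \<in> {c - 2 * \<rho>..d + 2 * \<rho>}" if "t \<in> {0..T}" "\<bar>v - y t\<bar> \<le> 2 * \<rho>" for t v
  proof -
    have "y t \<in> {c..d}" using cd(1) that(1) by blast
    then show ?thesis using that(2) by auto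
  qed
  ultimately show thesis using that[of \<rho>] \<epsilon>(1) by (auto simp: \<rho>_def)
qed

lemma step_size_eventually_small:
  fixes T h0 :: real
  assumes "T > 0" "h0 > 0"
  obtains N0 where "N0 \<ge> 1" "\<And>N. N \<ge> N0 \<Longrightarrow> T / real N < h0"
proof -
  obtain N0 where N0: "T / h0 < real N0" using reals_Archimedean2 by blast
  then have pos: "0 < real N0" using assms by (meson divide_pos_pos less_trans)
  have "T / real N < h0" if "N \<ge> N0" for N
  proof -
    have "T / h0 < real N" "0 < real N" using N0 pos that by linarith+
    then show ?thesis using assms by (simp add: field_simps)
  qed
  then show thesis using that[of N0] pos by simp
qed

section \<open>Exactness for polynomials\<close>

lemma iterated_deriv_eq_poly:
  fixes p :: "real poly"
  assumes "open D" "\<And>x. x \<in> D \<Longrightarrow> f x = poly p x" "x \<in> D"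
  shows "(deriv ^^ j) f x = poly ((pderiv ^^ j) p) x"
  using \<open>x \<in> D\<close>
proof (induction j arbitrary: x)
  case (Suc j)
  have "((deriv ^^ j) f has_real_derivative poly (pderiv ((pderiv ^^ j) p)) x) (at x)"
    by (rule has_field_derivative_transform_within_open[OF poly_DERIV \<open>open D\<close> Suc.prems])
      (simp add: Suc.IH)
  then show ?case by (simp add: DERIV_imp_deriv)
qed (use assms in simp)

lemma iterated_pderiv_eq_0:
  fixes p :: "real poly"
  shows "degree p \<le> r \<Longrightarrow> (pderiv ^^ Suc r) p = 0"
proof (induction r arbitrary: p)
  case (Suc r)
  then show ?case by (subst funpow_Suc_right) (simp add: degree_pderiv del: funpow.simps)
qed (simp add: pderiv_eq_0_iff)

text \<open>
  The expansion is made for \<open>p\<close> rather than for \<open>f\<close>, so the identity holds for all \<open>w\<close>. This is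
  needed because the flow of the Taylor polynomial is not known in advance to stay in \<open>D\<close>.
\<close>

lemma taylor_rhs_eq_poly:
  fixes p :: "real poly"
  assumes "open D" "\<And>x. x \<in> D \<Longrightarrow> f x = poly p x" "degree p \<le> r" "x \<in> D"
  shows "taylor_rhs r f w x = poly p (x + w)"
proof -
  let ?diff = "\<lambda>m w. poly ((pderiv ^^ m) p) (x + w)"
  have "\<exists>t. \<bar>t\<bar> \<le> \<bar>w\<bar> \<and> poly p (x + w)
      = (\<Sum>m<Suc r. ?diff m 0 / fact m * w ^ m) + ?diff (Suc r) t / fact (Suc r) * w ^ Suc r"
  proof (rule Maclaurin_all_le)
    show "\<forall>m s. (?diff m has_real_derivative ?diff (Suc m) s) (at s)"
      by (auto intro!: derivative_eq_intros)
  qed simp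
  then show ?thesis
    unfolding iterated_pderiv_eq_0[OF assms(3)] taylor_rhs_def
    by (simp add: iterated_deriv_eq_poly[OF assms(1,2,4)] lessThan_Suc_atMost)
qed

text \<open>
  A step may only be estimated if its starting point is within \<open>\<rho>\<close> of the curve, and this in turn
  follows from the error bound at the preceding grid points. The step size is therefore chosen so
  small that the final bound \<open>M * h ^ (r + 1)\<close> is at most \<open>\<rho>\<close>, which closes the induction.
\<close>

lemma taylor_method_convergent:
  assumes "open D" and C1: "continuously_differentiable_times_on (r + 1) f D" and "T > 0"
    and y': "\<forall>t\<in>{0..T}. (y has_real_derivative f (y t)) (at t within {0..T})"
  shows "convergent_one_step_method D (taylor_domain r f D) (taylor_step r f) (r + 1) T y"
  unfolding convergent_one_step_method_def
proof (intro allI impI, elim conjE)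
  fix K assume "compact K" "K \<subseteq> D" and yK: "y ` {0..T} \<subseteq> interior K"
  have y_cont: "continuous_on {0..T} y"
    using y' by (meson DERIV_continuous continuous_on_eq_continuous_within)
  obtain a b \<rho> where \<rho>: "0 < \<rho>" "\<rho> \<le> 1" and J_K: "{a..b} \<subseteq> interior K"
    and J: "\<And>t v. t \<in> {0..T} \<Longrightarrow> \<bar>v - y t\<bar> \<le> 2 * \<rho> \<Longrightarrow> v \<in> {a..b}"
    using interval_around_curve[OF \<open>T > 0\<close> y_cont open_interior yK] by metis
  let ?J = "{a..b}"
  have JD: "?J \<subseteq> D" using J_K interior_subset \<open>K \<subseteq> D\<close> by blast
  have "\<And>x. x \<in> ?J \<Longrightarrow> (f has_real_derivative deriv f x) (at x)"
    using iterated_deriv_has_derivative[OF \<open>open D\<close> C1, of 0] JD by auto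
  moreover have "continuous_on ?J (deriv f)"
    using iterated_deriv_continuous_on[OF \<open>open D\<close> C1, of 1] JD by (auto intro: continuous_on_subset)
  ultimately obtain L where L: "L-lipschitz_on ?J f"
    by (rule lipschitz_on_interval_if_C1)
  have L0: "0 \<le> L" by (rule lipschitz_on_nonneg[OF L])
  have C1': "continuously_differentiable_times_on r f D"
    unfolding continuously_differentiable_times_on_def
    using C1 iterated_deriv_continuous_on[OF \<open>open D\<close> C1, of r]
    by (auto simp: continuously_differentiable_times_on_def)
  obtain B L' where B: "B > 0"
      "\<And>x w. x \<in> ?J \<Longrightarrow> \<bar>w\<bar> \<le> 1 \<Longrightarrow> \<bar>taylor_rhs r f w x\<bar> \<le> B"
    and L': "\<And>x. x \<in> ?J \<Longrightarrow> L'-lipschitz_on (cball 0 1) (\<lambda>w. taylor_rhs r f w x)"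
    using taylor_rhs_bounds_on_compact[OF \<open>open D\<close> C1' compact_Icc JD] by metis
  have L'0: "L' \<ge> 0" using lipschitz_on_nonneg[OF L'[OF J[of 0 "y 0"]]] \<open>T > 0\<close> \<rho> by simp
  have "bounded ((deriv ^^ (r + 1)) f ` ?J)"
    using iterated_deriv_continuous_on[OF \<open>open D\<close> C1 order_refl] JD
    by (intro compact_imp_bounded compact_continuous_image) (auto intro: continuous_on_subset)
  then obtain C where C: "C > 0" "\<And>t. t \<in> ?J \<Longrightarrow> \<bar>(deriv ^^ (r + 1)) f t\<bar> \<le> C"
    unfolding bounded_pos real_norm_def by blast
  define C' where "C' = C / fact (r + 1)"
  have C'0: "C' \<ge> 0" using C(1) by (simp add: C'_def del: fact_Suc)
  have rem: "\<bar>f z - taylor_rhs r f (z - x) x\<bar> \<le> C' * \<bar>z - x\<bar> ^ (r + 1)"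
    if "x \<in> ?J" "z \<in> ?J" for x z
    unfolding C'_def by (rule taylor_remainder_bound[OF \<open>open D\<close> C1 JD C(2) that])
  define M where "M = exp (L * T) * (T * (C' * B ^ (r + 1)))"
  have M0: "M \<ge> 0" using \<open>T > 0\<close> C'0 B(1) by (simp add: M_def)
  \<comment> \<open>\<open>\<tau>\<close> is a time of existence common to all base points in the interval: the flow moves by at
      most \<open>\<rho>\<close> and the Picard operator contracts.\<close>
  define \<tau> where "\<tau> = min (\<rho> / B) (1 / (L' + 1))"
  have "\<tau> > 0" using \<rho> B(1) L'0 by (simp add: \<tau>_def)
  have "B * \<tau> \<le> B * (\<rho> / B)" "L' * \<tau> \<le> L' * (1 / (L' + 1))"
    using B(1) L'0 by (intro mult_left_mono; simp add: \<tau>_def)+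
  moreover have "L' * (1 / (L' + 1)) < 1" using L'0 by simp
  ultimately have \<tau>: "B * \<tau> \<le> \<rho>" "L' * \<tau> < 1" using B(1) by auto
  define h0 where "h0 = min \<tau> (min 1 (\<rho> / (M + 1)))"
  have "h0 > 0" using \<open>\<tau> > 0\<close> \<rho> M0 by (simp add: h0_def)
  obtain N0 where N0: "N0 \<ge> 1" "\<And>N. N \<ge> N0 \<Longrightarrow> T / real N < h0"
    using step_size_eventually_small[OF \<open>T > 0\<close> \<open>h0 > 0\<close>] by blast
  have flow: "t \<in> maximal_interval (\<lambda>w. taylor_rhs r f w x) 0
      \<and> \<bar>maximal_flow (\<lambda>w. taylor_rhs r f w x) 0 t\<bar> \<le> B * \<bar>t\<bar>"
    if "x \<in> ?J" "\<bar>t\<bar> < \<tau>" for x t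
    using taylor_flow_on_short_interval[of L' \<rho> r f x B \<tau> t] that \<tau> \<rho> \<open>\<tau> > 0\<close> B(2)
      lipschitz_on_subset[OF L', of x "cball 0 \<rho>"] by (auto simp: subset_eq)
  show "\<exists>N0\<ge>1. \<exists>M\<ge>0. \<forall>N\<ge>N0. let h = T / real N; s = one_step_seq (taylor_step r f) h (y 0) in
          one_step_well_defined D (taylor_domain r f D) (taylor_step r f) h (y 0) N \<and>
          (\<forall>n\<le>N. s n \<in> interior K) \<and>
          Max ((\<lambda>n. \<bar>y (real n * h) - s n\<bar>) ` {0..N}) \<le> M * h ^ (r + 1)"
  proof (intro exI[of _ N0] exI[of _ M] conjI allI impI N0(1) M0)
    fix N assume N: "N \<ge> N0"
    define h where "h = T / real N"
    define s where "s = one_step_seq (taylor_step r f) h (y 0)"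
    have "real N > 0" using N N0(1) by simp
    then have h: "0 < h" "h < \<tau>" "h < 1" "h < \<rho> / (M + 1)" and Nh: "real N * h = T"
      using N0(2)[OF N] \<open>T > 0\<close> by (auto simp: h_def h0_def)
    have Mh: "M * h ^ (r + 1) \<le> \<rho>"
    proof -
      have "M * h ^ (r + 1) \<le> (M + 1) * h"
        using h M0 power_decreasing[of 1 "r + 1" h] by (intro mult_mono) auto
      also have "\<dots> \<le> \<rho>" using h(4) M0 by (simp add: field_simps)
      finally show ?thesis .
    qed
    \<comment> \<open>the bound for the defect during a step, multiplied by the length of the step\<close>
    define E where "E = C' * (B * h) ^ (r + 1) * h"
    have E0: "E \<ge> 0" using C'0 B(1) h by (simp add: E_def)
    have nh_le: "real n * h \<le> T" if "n \<le> N" for n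
      using that h(1) Nh by (metis mult_right_mono less_imp_le of_nat_mono)
    have accumulated: "exp (L * (real n * h)) * (real n * E) \<le> M * h ^ (r + 1)" if "n \<le> N" for n
    proof -
      have "exp (L * (real n * h)) * (real n * h * (C' * B ^ (r + 1)))
          \<le> exp (L * T) * (T * (C' * B ^ (r + 1)))"
        using nh_le[OF that] L0 C'0 B(1) h(1) \<open>T > 0\<close>
        by (intro mult_mono mult_nonneg_nonneg) (auto intro: mult_left_mono)
      then have "exp (L * (real n * h)) * (real n * h * (C' * B ^ (r + 1))) * h ^ (r + 1)
          \<le> M * h ^ (r + 1)"
        unfolding M_def using h(1) by (intro mult_right_mono) auto
      then show ?thesis by (simp add: E_def power_mult_distrib ac_simps)
    qed
    have step: "\<bar>y (real (Suc n) * h) - s (Suc n)\<bar> \<le> exp (L * h) * (\<bar>y (real n * h) - s n\<bar> + E)"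
      if "n < N" and close: "\<bar>y (real n * h) - s n\<bar> \<le> \<rho>" for n
    proof -
      let ?g = "\<lambda>w. taylor_rhs r f w (s n)"
      let ?w = "maximal_flow ?g 0"
      have nh: "real n * h \<in> {0..T}" "real n * h + h \<le> T"
        using nh_le[of n] nh_le[of "Suc n"] \<open>n < N\<close> h(1) by (auto simp: algebra_simps)
      have sn_J: "s n \<in> ?J" using J[OF nh(1), of "s n"] close \<rho>(1) by auto
      have sol: "autonomous_solution ?g 0 (maximal_interval ?g 0) ?w"
        by (rule maximal_flow_solution[OF taylor_rhs_lipschitz_on_bounded_intervals])
      have w_bound: "\<bar>?w \<sigma>\<bar> \<le> B * \<sigma>" if "\<sigma> \<in> {0..h}" for \<sigma>
        using flow[OF sn_J, of \<sigma>] that h by auto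
      have w_J: "s n + ?w \<sigma> \<in> ?J" if "\<sigma> \<in> {0..h}" for \<sigma>
      proof -
        have "B * \<sigma> \<le> B * \<tau>" using that h B(1) by (intro mult_left_mono) auto
        then have "\<bar>?w \<sigma>\<bar> \<le> \<rho>" using w_bound[OF that] \<tau>(1) by linarith
        then show ?thesis using J[OF nh(1), of "s n + ?w \<sigma>"] close by auto
      qed
      have "\<bar>y (real n * h + h) - (s n + ?w h)\<bar>
          \<le> exp (L * h) * (\<bar>y (real n * h) - s n\<bar> + C' * (B * h) ^ (r + 1) * h)"
      proof (rule taylor_step_error[OF L rem C'0 less_imp_le[OF B(1)] less_imp_le[OF h(1)] sn_J
            _ _ w_bound w_J])
        show "?w 0 = 0" using sol by (simp add: autonomous_solution_def)
        show "(?w has_real_derivative taylor_rhs r f (?w \<sigma>) (s n)) (at \<sigma>)" if "\<sigma> \<in> {0..h}" for \<sigma>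
          using sol flow[OF sn_J, of \<sigma>] that h by (auto simp: autonomous_solution_def)
        show "continuous_on {real n * h..real n * h + h} y"
          using nh by (intro continuous_on_subset[OF y_cont]) auto
        show "(y has_real_derivative f (y \<sigma>)) (at \<sigma>)"
          if "real n * h < \<sigma>" "\<sigma> < real n * h + h" for \<sigma>
          using closed_interval_solution_interior_derivative[OF y', of \<sigma>] that nh
          by (simp add: le_less_trans[of 0 "real n * h" \<sigma>])
        show "y \<sigma> \<in> ?J" if "\<sigma> \<in> {real n * h..real n * h + h}" for \<sigma>
        proof -
          have "\<sigma> \<in> {0..T}" using that nh unfolding atLeastAtMost_iff by linarith
          then show ?thesis using J[of \<sigma> "y \<sigma>"] \<rho>(1) by simp
        qed
      qed
      then show ?thesis by (simp add: s_def taylor_step_def E_def algebra_simps)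
    qed
    have error: "\<bar>y (real n * h) - s n\<bar> \<le> exp (L * (real n * h)) * (real n * E)" if "n \<le> N" for n
      using that
    proof (induction n)
      case (Suc n)
      have IH: "\<bar>y (real n * h) - s n\<bar> \<le> exp (L * (real n * h)) * (real n * E)"
        using Suc by simp
      also have "\<dots> \<le> \<rho>" using accumulated[of n] Mh Suc.prems by simp
      finally have "\<bar>y (real (Suc n) * h) - s (Suc n)\<bar>
          \<le> exp (L * h) * (\<bar>y (real n * h) - s n\<bar> + E)"
        using step[of n] Suc.prems by simp
      also have "\<dots> \<le> exp (L * h) * (exp (L * (real n * h)) * (real n * E) + exp (L * (real n * h)) * E)"
        using IH E0 L0 h(1) mult_right_mono[of 1 "exp (L * (real n * h))" E]
        by (intro mult_left_mono add_mono) auto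
      also have "\<dots> = exp (L * (real (Suc n) * h)) * (real (Suc n) * E)"
        by (simp add: algebra_simps exp_add)
      finally show ?case .
    qed (simp add: s_def)
    have error_M: "\<bar>y (real n * h) - s n\<bar> \<le> M * h ^ (r + 1)" if "n \<le> N" for n
      using error[OF that] accumulated[OF that] by linarith
    have s_J: "s n \<in> ?J" if "n \<le> N" for n
      using J[of "real n * h" "s n"] error_M[OF that] Mh nh_le[OF that] h(1) \<rho>(1) by auto
    have "one_step_well_defined D (taylor_domain r f D) (taylor_step r f) h (y 0) N"
      unfolding one_step_well_defined_def taylor_domain_def s_def[symmetric]
      using s_J JD flow[of _ h] h by auto
    moreover have "\<forall>n\<le>N. s n \<in> interior K" using s_J J_K by blast
    moreover have "Max ((\<lambda>n. \<bar>y (real n * h) - s n\<bar>) ` {0..N}) \<le> M * h ^ (r + 1)"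
      using error_M by (subst Max_le_iff) auto
    ultimately show "let h = T / real N; s = one_step_seq (taylor_step r f) h (y 0) in
          one_step_well_defined D (taylor_domain r f D) (taylor_step r f) h (y 0) N \<and>
          (\<forall>n\<le>N. s n \<in> interior K) \<and>
          Max ((\<lambda>n. \<bar>y (real n * h) - s n\<bar>) ` {0..N}) \<le> M * h ^ (r + 1)"
      by (simp add: Let_def h_def s_def)
  qed
qed

text \<open>
  Both curves are solutions of \<open>v' = p(v)\<close> with the same initial value, so they coincide at time
  \<open>h\<close>, however large \<open>h\<close> is.
\<close>

lemma taylor_step_exact:
  fixes p :: "real poly"
  assumes "open D" and f: "\<And>x. x \<in> D \<Longrightarrow> f x = poly p x" and "degree p \<le> r"
    and dom: "(h, u t) \<in> taylor_domain r f D" and "0 \<le> h"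
    and u_cont: "continuous_on {t..t + h} u"
    and u': "\<And>s. t < s \<Longrightarrow> s < t + h \<Longrightarrow> (u has_real_derivative f (u s)) (at s)"
    and u_D: "\<And>s. s \<in> {t..t + h} \<Longrightarrow> u s \<in> D"
  shows "taylor_step r f h (u t) = u (t + h)"
proof -
  let ?x = "u t"
  let ?g = "\<lambda>w. taylor_rhs r f w ?x"
  let ?w = "maximal_flow ?g 0"
  have x: "?x \<in> D" and h: "h \<in> maximal_interval ?g 0"
    using dom by (auto simp: taylor_domain_def)
  have sol: "autonomous_solution ?g 0 (maximal_interval ?g 0) ?w"
    by (rule maximal_flow_solution[OF taylor_rhs_lipschitz_on_bounded_intervals])
  have w: "s \<in> maximal_interval ?g 0" if "s \<in> {0..h}" for s
    using autonomous_solution_closed_segment[OF sol h, of s] that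
    by (auto simp: closed_segment_eq_real_ivl)
  then have w': "(?w has_real_derivative poly p (?x + ?w s)) (at s)" if "s \<in> {0..h}" for s
    using sol that taylor_rhs_eq_poly[OF \<open>open D\<close> f \<open>degree p \<le> r\<close> x]
    by (auto simp: autonomous_solution_def)
  have "?x + ?w h = u (t + h)"
  proof (rule solution_unique_forward[OF poly_lipschitz_on_bounded_intervals[of p] \<open>0 \<le> h\<close>,
        where u = "\<lambda>s. ?x + ?w s" and v = "\<lambda>s. u (t + s)"])
    show "continuous_on {0..h} (\<lambda>s. ?x + ?w s)"
      using w by (intro continuous_on_add continuous_on_const
          continuous_on_subset[OF autonomous_solution_continuous[OF sol]]) auto
    show "continuous_on {0..h} (\<lambda>s. u (t + s))"
      by (auto intro!: continuous_intros continuous_on_compose2[OF u_cont])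
    fix s assume s: "0 < s" "s < h"
    then show "((\<lambda>s. ?x + ?w s) has_real_derivative poly p (?x + ?w s)) (at s)"
      using w'[of s] by (auto intro!: derivative_eq_intros)
    show "((\<lambda>s. u (t + s)) has_real_derivative poly p (u (t + s))) (at s)"
      using u'[of "t + s"] f[OF u_D, of "t + s"] s
      by (simp add: DERIV_shift[symmetric] add.commute)
  qed (use sol in \<open>simp add: autonomous_solution_def\<close>)
  then show ?thesis by (simp add: taylor_step_def)
qed

section \<open>Convergence order and exactness of the Taylor method\<close>

theorem theorem2p9:
  fixes r :: nat and D :: "real set" and f y :: "real \<Rightarrow> real" and T y0 :: real
  assumes "open D"
    and "continuously_differentiable_times_on (r + 1) f D"
    and "T > 0"
    and "\<forall>t\<in>{0..T}. y t \<in> D"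
    and "\<forall>t\<in>{0..T}. (y has_real_derivative f (y t)) (at t within {0..T})"
    and "y0 \<in> D" and "y 0 = y0"
  shows "convergent_one_step_method D (taylor_domain r f D) (taylor_step r f) (r + 1) T y \<and>
    ((\<exists>p :: real poly. degree p \<le> r \<and> (\<forall>x\<in>D. f x = poly p x)) \<longrightarrow>
       (\<forall>N\<ge>1. let h = T / real N in
          one_step_well_defined D (taylor_domain r f D) (taylor_step r f) h y0 N \<longrightarrow>
          (\<forall>n\<le>N. one_step_seq (taylor_step r f) h y0 n = y (real n * h))))"
proof (intro conjI impI)
  show "convergent_one_step_method D (taylor_domain r f D) (taylor_step r f) (r + 1) T y"
    by (rule taylor_method_convergent[OF assms(1-3,5)])
next
  assume "\<exists>p :: real poly. degree p \<le> r \<and> (\<forall>x\<in>D. f x = poly p x)"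
  then obtain p :: "real poly" where p: "degree p \<le> r" "\<And>x. x \<in> D \<Longrightarrow> f x = poly p x" by blast
  show "\<forall>N\<ge>1. let h = T / real N in
          one_step_well_defined D (taylor_domain r f D) (taylor_step r f) h y0 N \<longrightarrow>
          (\<forall>n\<le>N. one_step_seq (taylor_step r f) h y0 n = y (real n * h))"
    unfolding Let_def
  proof (intro allI impI)
    fix N n :: nat
    define h where "h = T / real N"
    let ?s = "one_step_seq (taylor_step r f) h y0"
    assume "1 \<le> N" and "one_step_well_defined D (taylor_domain r f D) (taylor_step r f) (T / real N) y0 N"
      and "n \<le> N"
    then have dom: "(h, ?s m) \<in> taylor_domain r f D" if "m < N" for m
      using that by (simp add: one_step_well_defined_def h_def)
    have h: "0 \<le> h" "real N * h = T" using \<open>1 \<le> N\<close> \<open>T > 0\<close> by (auto simp: h_def)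
    have y_cont: "continuous_on {0..T} y"
      using assms(5) by (meson DERIV_continuous continuous_on_eq_continuous_within)
    have "?s n = y (real n * h)" using \<open>n \<le> N\<close>
    proof (induction n)
      case (Suc m)
      have "real m * h + h \<le> T"
        using mult_right_mono[of "real (Suc m)" "real N" h] Suc.prems h by (simp add: algebra_simps)
      then have mh: "{real m * h..real m * h + h} \<subseteq> {0..T}" using h(1) by auto
      have "taylor_step r f h (y (real m * h)) = y (real m * h + h)"
      proof (rule taylor_step_exact[OF \<open>open D\<close> p(2,1) _ h(1)])
        show "(h, y (real m * h)) \<in> taylor_domain r f D"
          using dom[of m] Suc by simp
        show "continuous_on {real m * h..real m * h + h} y"
          by (rule continuous_on_subset[OF y_cont mh])
        show "y t \<in> D" if "t \<in> {real m * h..real m * h + h}" for t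
          using that mh assms(4) by blast
        show "(y has_real_derivative f (y t)) (at t)"
          if "real m * h < t" "t < real m * h + h" for t
          using closed_interval_solution_interior_derivative[OF assms(5), of t] that h(1)
            \<open>real m * h + h \<le> T\<close> mult_nonneg_nonneg[of "real m" h] by linarith
      qed
      then show ?case using Suc by (simp add: algebra_simps)
    qed (use assms in simp)
    then show "one_step_seq (taylor_step r f) (T / real N) y0 n = y (real n * (T / real N))"
      by (simp add: h_def)
  qed
qed

end
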